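(* Let $U,V$ be real-valued random variables on a common probability space with $\mathbb{P}(U>0)>0$, $\mathbb{P}(V>0)>0$, $\mathbb{E}[U]<0$, $\mathbb{E}[V]<0$, and such that $\mathbb{E}[e^{\theta U}]<\infty$ and $\mathbb{E}[e^{\theta V}]<\infty$ for some $\theta>0$. Define $$\theta_1:=\sup\{r>0:\mathbb{E}[e^{rU}]\le 1\},\qquad \theta_2:=\sup\{r>0:\max\{\mathbb{E}[e^{rV}],\mathbb{E}[e^{rU}]\}\le 1\},$$ and $I_V(r):=1$ if $\mathbb{E}[e^{rV}]=1$, $I_V(r):=0$ otherwise. Let $a\in\mathbb{R}$ and $$\mathcal{D}_a:=\{(u,v)\in\mathbb{R}^2:\ u\ge -a_+,\ v\ge(-a)\vee u\}.$$ Assume that there exists a constant $K<\infty$ such that for all $v\ge 0$ $$\mathbb{E}\left[(V-v)e^{\theta_2(V-v)}\mid V>v\right]\le K.$$ Then there exist a constant $P_1\ge 0$ and a polynomial $P_2:\mathbb{R}^2\to\mathbb{R}$ of degree $I_V(\theta_2)$ satisfying $P_2(u,v)\ge 0$ for all $(u,v)\in\mathcal{D}_a$, such that the function $$\gamma(u,v):=\mathbf{1}_{\{(u,v)\in\mathcal{D}_a\}}\left[1-P_1e^{-\theta_1u}-P_2(u,v)e^{-\theta_2v}\right],\qquad (u,v)\in\overline{\mathbb{R}}^2\setminus\{(\infty,\infty)\},$$ is bounded above, satisfies $\gamma(\infty,\infty):=\limsup_{u,v\to\infty}\gamma(u,v)=1$, and satisfies for all $(u,v)\in\operatorname{supp}(\gamma\vee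 0)$ $$\mathbb{E}\left[\mathbf{1}_{\{u\ge U\}}\,\gamma\big((u-U)\wedge(v-V),\,v-V\big)\right]\ge\gamma(u,v).$$
   Context: Notation: $\overline{\mathbb{R}}:=\mathbb{R}\cup\{\pm\infty\}$, $u_+:=\max\{u,0\}$, $u\wedge v:=\min\{u,v\}$, $u\vee v:=\max\{u,v\}$, $\operatorname{supp}(\gamma\vee0):=\{(u,v):\gamma(u,v)>0\}$. The function $\gamma$ is $0$ at all points outside $\mathcal{D}_a$ other than $(\infty,\infty)$, where its value is the stated $\limsup$. The $\limsup$ is over $(u,v)\to(\infty,\infty)$. The condition on the conditional expectation is required for those $v\ge0$ with $\mathbb{P}(V>v)>0$. In the paper $U\simeq Y-X$ and $V\simeq Z-X$, where $X$ is the inter-arrival time and $Y,Z$ the service times in a two-queue tandem. *)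

theory Defs
  imports "HOL-Probability.Probability"
begin

text \<open>Expectation with values in \<open>[-\<infinity>, \<infinity>]\<close>, so that \<open>E[U] < 0\<close> does not exclude \<open>E[U] = -\<infinity>\<close>.
  If positive and negative part both have infinite expectation the value is \<open>\<infinity> - \<infinity> = \<infinity>\<close>,
  which is not negative.\<close>

definition ext_expectation :: "'a measure \<Rightarrow> ('a \<Rightarrow> real) \<Rightarrow> ereal" where
  "ext_expectation M X =
     enn2ereal (\<integral>\<^sup>+x. ennreal (X x) \<partial>M) - enn2ereal (\<integral>\<^sup>+x. ennreal (- X x) \<partial>M)"

lemma ext_expectation_eq_integral:
  assumes "integrable M X"
  shows "ext_expectation M X = ereal (integral\<^sup>L M X)"
proof -
  have "(\<integral>\<^sup>+x. ennreal (X x) \<partial>M) \<noteq> \<infinity>" "(\<integral>\<^sup>+x. ennreal (- X x) \<partial>M) \<noteq> \<infinity>"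
    using assms by (auto simp: real_integrable_def)
  then show ?thesis
    unfolding ext_expectation_def real_lebesgue_integral_def[OF assms]
    by (cases "\<integral>\<^sup>+x. ennreal (X x) \<partial>M"; cases "\<integral>\<^sup>+x. ennreal (- X x) \<partial>M")
       (auto simp: enn2ereal_ennreal)
qed

definition mgf :: "'a measure \<Rightarrow> ('a \<Rightarrow> real) \<Rightarrow> real \<Rightarrow> ennreal" where
  "mgf M X r = (\<integral>\<^sup>+x. ennreal (exp (r * X x)) \<partial>M)"

definition theta1 :: "'a measure \<Rightarrow> ('a \<Rightarrow> real) \<Rightarrow> real" where
  "theta1 M U = Sup {r. 0 < r \<and> mgf M U r \<le> 1}"

definition theta2 :: "'a measure \<Rightarrow> ('a \<Rightarrow> real) \<Rightarrow> ('a \<Rightarrow> real) \<Rightarrow> real" where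
  "theta2 M U V = Sup {r. 0 < r \<and> max (mgf M V r) (mgf M U r) \<le> 1}"

definition I_ind :: "'a measure \<Rightarrow> ('a \<Rightarrow> real) \<Rightarrow> real \<Rightarrow> nat" where
  "I_ind M V r = (if mgf M V r = 1 then 1 else 0)"

definition D_set :: "real \<Rightarrow> (real \<times> real) set" where
  "D_set a = {(u, v). u \<ge> - max a 0 \<and> v \<ge> max (- a) u}"

text \<open>Conditional expectation given the event \<open>V > v\<close> of the integrand
  \<open>(V - v) exp (\<theta> (V - v))\<close>, which is nonnegative on that event.\<close>

definition cond_exp_excess :: "'a measure \<Rightarrow> ('a \<Rightarrow> real) \<Rightarrow> real \<Rightarrow> real \<Rightarrow> ennreal" where
  "cond_exp_excess M V \<theta> v =
     (\<integral>\<^sup>+x. ennreal ((V x - v) * exp (\<theta> * (V x - v)))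
        \<partial>uniform_measure M {x \<in> space M. V x > v})"

text \<open>Polynomial functions of two variables whose total degree is exactly \<open>d\<close>; in particular,
  the zero polynomial does not have degree \<open>0\<close>.\<close>

definition polynomial2_of_degree :: "nat \<Rightarrow> (real \<Rightarrow> real \<Rightarrow> real) \<Rightarrow> bool" where
  "polynomial2_of_degree d P \<longleftrightarrow>
     (\<exists>c :: nat \<Rightarrow> nat \<Rightarrow> real.
        (\<forall>u v. P u v = (\<Sum>i\<le>d. \<Sum>j\<le>d - i. c i j * u ^ i * v ^ j)) \<and>
        (\<exists>i\<le>d. c i (d - i) \<noteq> 0))"

text \<open>The formula for \<open>\<gamma>\<close> away from \<open>(\<infinity>, \<infinity>)\<close>. Its value at \<open>(\<infinity>, \<infinity>)\<close> is irrelevant, since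
  the filter \<open>at (\<infinity>, \<infinity>)\<close> is punctured.\<close>

definition gamma_off :: 
  "real \<Rightarrow> real \<Rightarrow> real \<Rightarrow> real \<Rightarrow> (real \<Rightarrow> real \<Rightarrow> real) \<Rightarrow> ereal \<times> ereal \<Rightarrow> real" where
  "gamma_off a \<theta>1 \<theta>2 P1 P2 = (\<lambda>(u, v).
     if \<bar>u\<bar> \<noteq> \<infinity> \<and> \<bar>v\<bar> \<noteq> \<infinity> \<and> (real_of_ereal u, real_of_ereal v) \<in> D_set a
     then 1 - P1 * exp (- \<theta>1 * real_of_ereal u)
            - P2 (real_of_ereal u) (real_of_ereal v) * exp (- \<theta>2 * real_of_ereal v)
     else 0)"

definition gamma_limsup ::
  "real \<Rightarrow> real \<Rightarrow> real \<Rightarrow> real \<Rightarrow> (real \<Rightarrow> real \<Rightarrow> real) \<Rightarrow> ereal" where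
  "gamma_limsup a \<theta>1 \<theta>2 P1 P2 =
     Limsup (at (\<infinity>, \<infinity>)) (\<lambda>p. ereal (gamma_off a \<theta>1 \<theta>2 P1 P2 p))"

definition gamma_fun ::
  "real \<Rightarrow> real \<Rightarrow> real \<Rightarrow> real \<Rightarrow> (real \<Rightarrow> real \<Rightarrow> real) \<Rightarrow> ereal \<times> ereal \<Rightarrow> real" where
  "gamma_fun a \<theta>1 \<theta>2 P1 P2 p =
     (if p = (\<infinity>, \<infinity>) then real_of_ereal (gamma_limsup a \<theta>1 \<theta>2 P1 P2)
      else gamma_off a \<theta>1 \<theta>2 P1 P2 p)"

definition supp_pos :: "(ereal \<times> ereal \<Rightarrow> real) \<Rightarrow> (ereal \<times> ereal) set" where
  "supp_pos g = {p. g p > 0}"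

end

theory Submission
  imports Defs "HOL-Real_Asymp.Real_Asymp"
begin

text \<open>
  Write \<open>f u v = exp (- \<theta>1 * u) + P2 u v * exp (- \<theta>2 * v)\<close>, so that \<open>\<gamma> = 1 - f\<close> on the domain. The
  drift condition then says that \<open>f\<close> is superharmonic for the killed walk: \<open>f u v\<close> must dominate the
  probability that a step is lost plus the expectation of \<open>f\<close> after a step that survives. A step
  is killed if \<open>U > u\<close>; otherwise it stays in the domain exactly if \<open>V \<le> v + a\<close>. So it survives on
  the event \<open>U \<le> u \<and> V \<le> v + a\<close>.

  The first term of \<open>f\<close> pays for the condition \<open>U \<le> u\<close>. Since \<open>E (exp (\<theta>1 * U)) \<le> 1\<close>, the function
  \<open>exp (- \<theta>1 * u)\<close> is superharmonic for the walk driven by \<open>U\<close>, and after a step with \<open>U > u\<close> it is at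
  least one; hence the coefficient \<open>P1 = 1\<close> suffices. Replacing \<open>u - U\<close> by the smaller
  \<open>v - V\<close> in the minimum costs at most \<open>exp (\<theta>1 * (V - v))\<close>, and on \<open>V \<le> v + a\<close> this is at most
  \<open>C * exp (\<theta>2 * (V - v))\<close> with \<open>C = exp ((\<theta>1 - \<theta>2) * a)\<close>, because \<open>\<theta>2 \<le> \<theta>1\<close>. Its expectation is at
  most \<open>C * exp (- \<theta>2 * v)\<close>, the decay of the second term of \<open>f\<close>.

  The second term must therefore gain a fixed multiple of \<open>exp (- \<theta>2 * v)\<close> in each step. Let
  \<open>m = E (exp (\<theta>2 * V)) \<le> 1\<close>. If \<open>m < 1\<close>, a large constant \<open>P2 = c0\<close> gains \<open>c0 * (1 - m)\<close>. If \<open>m = 1\<close>,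
  a constant gains nothing, but \<open>P2 = c0 + c1 * v\<close> gains \<open>c1 * \<beta>\<close>, where
  \<open>\<beta> = E (V * exp (\<theta>2 * V)) > 0\<close> is the slope of the exponential moment
  (\<open>expectation_tilted_pos\<close>). With a linear term, \<open>P2\<close> becomes negative after a large upward jump of
  \<open>V\<close>, and discarding such jumps loses part of this gain. The loss is an expectation of
  \<open>(V - w) * exp (\<theta>2 * (V - w))\<close> over \<open>V > w\<close> with \<open>w = v + a \<ge> 0\<close>; by the hypothesis on \<open>K\<close> it is at
  most a multiple of the probability of \<open>V > w\<close>, and a sufficiently large \<open>c0\<close> makes up for it.
  These estimates are first made pointwise in \<open>drift_lower_bound\<close> and then integrated in
  \<open>drift_inequality\<close>; \<open>ex_balanced_coefficients\<close> chooses \<open>c0\<close> and \<open>c1\<close>.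

  It remains to see that \<open>0 < \<theta>2 \<le> \<theta>1 < \<infinity>\<close> and that both suprema keep the exponential moments at most
  one. Positivity comes from the negative drifts and a finite exponential moment, finiteness from
  the positive probability of upward jumps, and the bounds at the suprema from Fatou's lemma.
\<close>

section \<open>Exponential moments\<close>

text \<open>This is convexity of \<open>\<lambda>t. exp (t * x)\<close>: between \<open>0\<close> and \<open>s\<close> the chord lies above the graph.
  Equivalently, \<open>(exp (t * x) - 1) / t\<close> increases with \<open>t\<close>, which drives both the monotone
  convergence argument and the monotonicity of \<open>mgf \<le> 1\<close> below.\<close>

lemma exp_le_chord:
  fixes r s x :: real
  assumes "0 < r" "r \<le> s"
  shows "exp (r * x) - 1 \<le> (r / s) * (exp (s * x) - 1)"
proof -
  have "exp ((1 - r / s) *\<^sub>R 0 + (r / s) *\<^sub>R (s * x)) \<le> (1 - r / s) * exp 0 + (r / s) * exp (s * x)"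
    using assms by (intro convex_onD[OF exp_convex]) auto
  then show ?thesis
    using assms by (simp add: algebra_simps)
qed

lemma exp_difference_quotient_tendsto:
  fixes \<theta> x :: real
  assumes "0 < \<theta>"
  shows "(\<lambda>k. (exp (\<theta> / Suc k * x) - 1) / (\<theta> / Suc k)) \<longlonglongrightarrow> x"
proof -
  have "((\<lambda>t. exp (t * x)) has_real_derivative x) (at 0)"
    by (auto intro!: derivative_eq_intros)
  then have "((\<lambda>t. (exp (t * x) - 1) / t) \<longlongrightarrow> x) (at 0)"
    by (simp add: DERIV_def)
  moreover have "filterlim (\<lambda>k. \<theta> / Suc k) (at 0) sequentially"
    unfolding filterlim_at
    using LIMSEQ_Suc[OF lim_const_over_n[of \<theta>]] assms by auto
  ultimately show ?thesis
    by (rule filterlim_compose)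
qed

lemma integrable_exp_if_mgf_finite:
  assumes "X \<in> borel_measurable M" "mgf M X r < \<infinity>"
  shows "integrable M (\<lambda>x. exp (r * X x))"
  using assms by (intro integrableI_nonneg) (auto simp: mgf_def)

lemma mgf_eq_integral:
  assumes "integrable M (\<lambda>x. exp (r * X x))"
  shows "mgf M X r = ennreal (\<integral>x. exp (r * X x) \<partial>M)"
  using assms by (simp add: mgf_def nn_integral_eq_integral)

lemma (in prob_space) mgf_le_one_downward:
  assumes [measurable]: "X \<in> borel_measurable M"
    and "0 < r" "r \<le> s" and s: "mgf M X s \<le> 1"
  shows "mgf M X r \<le> 1"
proof -
  have int: "integrable M (\<lambda>x. exp (s * X x))"
    using s by (intro integrable_exp_if_mgf_finite) (auto intro: le_less_trans)
  have "expectation (\<lambda>x. exp (s * X x)) \<le> 1"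
    using s by (simp add: mgf_eq_integral[OF int])
  then have "(r / s) * (expectation (\<lambda>x. exp (s * X x)) - 1) \<le> 0"
    using assms by (intro mult_nonneg_nonpos) auto
  moreover have "expectation (\<lambda>x. 1 + (r / s) * (exp (s * X x) - 1))
      = 1 + (r / s) * (expectation (\<lambda>x. exp (s * X x)) - 1)"
    using int by (simp add: prob_space)
  ultimately have le_1: "expectation (\<lambda>x. 1 + (r / s) * (exp (s * X x) - 1)) \<le> 1"
    by linarith
  have "mgf M X r \<le> (\<integral>\<^sup>+x. ennreal (1 + (r / s) * (exp (s * X x) - 1)) \<partial>M)"
    unfolding mgf_def
    by (intro nn_integral_mono ennreal_leI) (use exp_le_chord[OF assms(2,3)] in \<open>smt (verit)\<close>)
  also have "\<dots> = ennreal (expectation (\<lambda>x. 1 + (r / s) * (exp (s * X x) - 1)))"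
    using int exp_le_chord[OF assms(2,3)]
    by (intro nn_integral_eq_integral AE_I2)
       (auto, smt (verit) exp_gt_zero)
  also have "\<dots> \<le> 1"
    using le_1 by (simp add: ennreal_le_1)
  finally show ?thesis .
qed

text \<open>Negative drift pushes the exponential moment below one near the origin: the difference
  quotients of \<open>t \<mapsto> E (exp (t * X))\<close> at \<open>0\<close> decrease to \<open>E X\<close>. If they all were nonnegative,
  monotone convergence would make \<open>X\<close> integrable with \<open>E X \<ge> 0\<close>; this covers
  \<open>E X = -\<infinity>\<close> as well.\<close>

lemma (in prob_space) ex_mgf_le_one_if_negative_drift:
  assumes X[measurable]: "X \<in> borel_measurable M"
    and neg: "ext_expectation M X < 0" and fin: "mgf M X \<theta> < \<infinity>" and \<theta>: "0 < \<theta>"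
  shows "\<exists>s>0. mgf M X s \<le> 1"
proof (rule ccontr)
  assume contra: "\<not> ?thesis"
  define r where "r k = \<theta> / Suc k" for k
  define f where "f k x = - ((exp (r k * X x) - 1) / r k)" for k x
  have r: "0 < r k" "r k \<le> \<theta>" for k
    using \<theta> by (auto simp: r_def field_simps)
  have int_exp: "integrable M (\<lambda>x. exp (r k * X x))" for k
  proof (rule Bochner_Integration.integrable_bound)
    show "integrable M (\<lambda>x. 1 + exp (\<theta> * X x))"
      using integrable_exp_if_mgf_finite[OF X fin] by auto
    have "exp (r k * X x) \<le> 1 + exp (\<theta> * X x)" for x
    proof (cases "0 \<le> X x")
      case True
      then have "exp (r k * X x) \<le> exp (\<theta> * X x)"
        using r[of k] by (auto intro: mult_right_mono)
      then show ?thesis by linarith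
    next
      case False
      then have "exp (r k * X x) \<le> 1"
        using r[of k] by (auto simp: mult_le_0_iff)
      then show ?thesis
        by (smt (verit) exp_gt_zero)
    qed
    then show "AE x in M. norm (exp (r k * X x)) \<le> norm (1 + exp (\<theta> * X x))"
      by (auto simp: abs_of_pos add_pos_pos)
  qed auto
  have int_f: "integrable M (f k)" for k
    unfolding f_def using int_exp[of k] by auto
  have f_nonpos: "expectation (f k) \<le> 0" for k
  proof -
    have "1 < expectation (\<lambda>x. exp (r k * X x))"
      using contra r(1)[of k] by (auto simp: mgf_eq_integral[OF int_exp] not_le)
    then show ?thesis
      unfolding f_def using r(1)[of k] int_exp[of k] by (simp add: prob_space)
  qed
  have mono_f: "mono (\<lambda>k. f k x)" for x
  proof (rule monoI)
    fix m n :: nat assume "m \<le> n"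
    then have "r n \<le> r m"
      using \<theta> by (auto simp: r_def intro!: divide_left_mono)
    then show "f m x \<le> f n x"
      using exp_le_chord[of "r n" "r m" "X x"] r(1)[of n] r(1)[of m]
      by (simp add: f_def field_simps)
  qed
  have "incseq (\<lambda>k. expectation (f k))"
    using mono_f int_f by (intro monoI integral_mono) (auto dest: monoD)
  from incseq_convergent[OF this] f_nonpos obtain L where
    L: "(\<lambda>k. expectation (f k)) \<longlonglongrightarrow> L" by blast
  have L_le: "L \<le> 0"
    using f_nonpos by (intro LIMSEQ_le_const2[OF L]) auto
  have lim: "(\<lambda>k. f k x) \<longlonglongrightarrow> - X x" for x
    unfolding f_def r_def by (intro tendsto_minus exp_difference_quotient_tendsto \<theta>)
  have "integrable M (\<lambda>x. - X x)" "expectation (\<lambda>x. - X x) = L"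
    by (rule integral_monotone_convergence integrable_monotone_convergence
        has_bochner_integral_monotone_convergence;
        use int_f mono_f lim L in auto)+
  then have "integrable M X" "expectation X = - L"
    by auto
  then show False
    using ext_expectation_eq_integral[of M X] neg L_le by auto
qed

text \<open>A variable that is positive with positive probability has an exponential moment that grows
  at least linearly, because \<open>exp (r * X) \<ge> r * max 0 X\<close>.\<close>

lemma (in prob_space) bdd_above_mgf_le_one:
  assumes X[measurable]: "X \<in> borel_measurable M" and pos: "\<P>(x in M. X x > 0) > 0"
  shows "bdd_above {r. 0 < r \<and> mgf M X r \<le> 1}"
proof -
  define c where "c = min 1 (\<integral>\<^sup>+x. ennreal (X x) \<partial>M)"
  have "(\<integral>\<^sup>+x. ennreal (X x) \<partial>M) \<noteq> 0"
  proof
    assume "(\<integral>\<^sup>+x. ennreal (X x) \<partial>M) = 0"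
    then have "AE x in M. \<not> X x > 0"
      by (auto simp: nn_integral_0_iff_AE ennreal_eq_0_iff)
    then have "\<P>(x in M. X x > 0) = 0"
      by (subst prob_eq_0) (auto simp: AE_conj_iff)
    with pos show False by simp
  qed
  then have c: "0 < enn2real c" "ennreal (enn2real c) = c"
    by (auto simp: c_def enn2real_positive_iff min_less_iff_disj zero_less_iff_neq_zero)
  show ?thesis
  proof (rule bdd_aboveI)
    fix r assume "r \<in> {r. 0 < r \<and> mgf M X r \<le> 1}"
    then have r: "0 < r" "mgf M X r \<le> 1" by auto
    have "ennreal (r * enn2real c) = ennreal r * c"
      using r c by (simp add: ennreal_mult)
    also have "\<dots> \<le> ennreal r * (\<integral>\<^sup>+x. ennreal (X x) \<partial>M)"
      unfolding c_def by (intro mult_left_mono) auto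
    also have "\<dots> = (\<integral>\<^sup>+x. ennreal (r * X x) \<partial>M)"
      using r by (simp add: nn_integral_cmult ennreal_mult')
    also have "\<dots> \<le> mgf M X r"
      unfolding mgf_def
      by (intro nn_integral_mono ennreal_leI) (smt (verit) exp_ge_add_one_self)
    also have "\<dots> \<le> 1" by fact
    finally have "r * enn2real c \<le> 1"
      by (simp add: ennreal_le_1)
    then show "r \<le> 1 / enn2real c"
      using c by (simp add: field_simps)
  qed
qed

text \<open>By Fatou's lemma the exponential moment is lower semicontinuous in its parameter, so
  sublevel sets contain their suprema. It may well jump to \<open>\<infinity>\<close> beyond them.\<close>

lemma mgf_Sup_le_one:
  assumes X[measurable]: "X \<in> borel_measurable M"
    and S: "\<And>r. r \<in> S \<Longrightarrow> mgf M X r \<le> 1" "S \<noteq> {}" "bdd_above S"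
  shows "mgf M X (Sup S) \<le> 1"
proof -
  obtain r where r: "\<And>n. r n \<in> S" "r \<longlonglongrightarrow> Sup S"
    using closure_contains_Sup[OF S(2,3)] unfolding closure_sequential by blast
  have "(\<lambda>n. ennreal (exp (r n * X x))) \<longlonglongrightarrow> ennreal (exp (Sup S * X x))" for x
    by (intro tendsto_intros r)
  then have "liminf (\<lambda>n. ennreal (exp (r n * X x))) = ennreal (exp (Sup S * X x))" for x
    by (intro lim_imp_Liminf) auto
  then have "mgf M X (Sup S) = (\<integral>\<^sup>+x. liminf (\<lambda>n. ennreal (exp (r n * X x))) \<partial>M)"
    unfolding mgf_def by simp
  also have "\<dots> \<le> liminf (\<lambda>n. mgf M X (r n))"
    unfolding mgf_def by (intro nn_integral_liminf) simp
  also have "\<dots> \<le> 1"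
    using Liminf_mono[of "\<lambda>n. mgf M X (r n)" "\<lambda>_. 1" sequentially] r(1) S(1)
    by (simp add: Liminf_const)
  finally show ?thesis .
qed

text \<open>At a positive parameter where the exponential moment returns to its value one at the origin,
  its slope is positive: integrate \<open>exp y - 1 \<le> y * exp y\<close>, in which equality forces \<open>y = 0\<close>.\<close>

lemma (in prob_space) expectation_tilted_pos:
  fixes X :: "'a \<Rightarrow> real" and \<theta> :: real
  assumes int: "integrable M (\<lambda>x. exp (\<theta> * X x))" "integrable M (\<lambda>x. X x * exp (\<theta> * X x))"
    and one: "expectation (\<lambda>x. exp (\<theta> * X x)) = 1" and \<theta>: "0 < \<theta>"
    and X[measurable]: "X \<in> borel_measurable M" and pos: "\<P>(x in M. X x > 0) > 0"
  shows "0 < expectation (\<lambda>x. X x * exp (\<theta> * X x))"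
proof -
  define g where "g x = \<theta> * (X x * exp (\<theta> * X x)) - (exp (\<theta> * X x) - 1)" for x
  have g_alt: "g x = exp (\<theta> * X x) * (exp (- (\<theta> * X x)) - (1 + - (\<theta> * X x)))" for x
  proof -
    have "exp (\<theta> * X x) * exp (- (\<theta> * X x)) = 1"
      by (rule exp_minus_inverse)
    then show ?thesis
      unfolding g_def by algebra
  qed
  have g_nonneg: "0 \<le> g x" for x
    unfolding g_alt using exp_ge_add_one_self[of "- (\<theta> * X x)"] by simp
  have int_g: "integrable M g"
    unfolding g_def using int by auto
  have exp_g: "expectation g = \<theta> * expectation (\<lambda>x. X x * exp (\<theta> * X x))"
    unfolding g_def using int one by (simp add: prob_space)
  have "expectation g \<noteq> 0"
  proof
    assume "expectation g = 0"
    then have "AE x in M. g x = 0"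
      using integral_nonneg_eq_0_iff_AE[OF int_g] g_nonneg by simp
    then have "AE x in M. \<not> X x > 0"
    proof (rule AE_mp, intro AE_I2 impI notI)
      fix x assume "g x = 0" "0 < X x"
      then have "exp (- (\<theta> * X x)) = 1 + - (\<theta> * X x)" by (simp add: g_alt)
      then have "\<theta> * X x = 0"
        using exp_minus_greater[of "\<theta> * X x"] by linarith
      with \<open>0 < X x\<close> \<theta> show False by simp
    qed
    then have "\<P>(x in M. X x > 0) = 0"
      by (subst prob_eq_0) (auto simp: AE_conj_iff)
    with pos show False by simp
  qed
  moreover have "0 \<le> expectation g"
    using g_nonneg by simp
  ultimately show ?thesis
    using \<theta> by (auto simp: exp_g zero_le_mult_iff less_le)
qed

section \<open>The drift inequality\<close>

text \<open>Multiplying out the conditioning turns the hypothesis on the conditional excess into a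
  bound that decays with the probability of \<open>V > w\<close>; this is what allows the loss from large jumps to
  be charged to those jumps. Since \<open>ennreal\<close> truncates negative numbers to \<open>0\<close>, the integral on the
  left only sees the event \<open>V > w\<close>.\<close>

lemma (in prob_space) excess_le_of_cond_exp_excess_le:
  assumes V[measurable]: "V \<in> borel_measurable M" and "0 \<le> K"
    and cond: "\<P>(x in M. V x > w) > 0 \<Longrightarrow> cond_exp_excess M V \<theta> w \<le> ennreal K"
  shows "(\<integral>\<^sup>+x. ennreal ((V x - w) * exp (\<theta> * (V x - w))) \<partial>M)
    \<le> ennreal (K * \<P>(x in M. V x > w))"
proof -
  define A where "A = {x \<in> space M. V x > w}"
  have A[measurable]: "A \<in> sets M" by (simp add: A_def)
  have eq: "(\<integral>\<^sup>+x. ennreal ((V x - w) * exp (\<theta> * (V x - w))) \<partial>M)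
      = (\<integral>\<^sup>+x. ennreal ((V x - w) * exp (\<theta> * (V x - w))) * indicator A x \<partial>M)"
    by (intro nn_integral_cong)
       (auto simp: A_def indicator_def ennreal_eq_0_iff mult_nonpos_nonneg)
  show ?thesis
  proof (cases "prob A = 0")
    case True
    then have "AE x in M. x \<notin> A"
      using prob_eq_0[OF A] by simp
    then have "(\<integral>\<^sup>+x. ennreal ((V x - w) * exp (\<theta> * (V x - w))) * indicator A x \<partial>M) = 0"
      by (subst nn_integral_0_iff_AE) (auto simp: indicator_def)
    then show ?thesis by (simp add: eq)
  next
    case False
    then have pos: "0 < prob A"
      by (simp add: zero_less_measure_iff)
    let ?I = "\<integral>\<^sup>+x. ennreal ((V x - w) * exp (\<theta> * (V x - w))) * indicator A x \<partial>M"
    have "?I / emeasure M A \<le> ennreal K"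
      using cond pos unfolding cond_exp_excess_def A_def[symmetric]
      by (simp add: nn_integral_uniform_measure)
    then have "?I / emeasure M A * emeasure M A \<le> ennreal K * emeasure M A"
      by (rule mult_right_mono) simp
    moreover have "?I / emeasure M A * emeasure M A = ?I"
      using pos by (simp add: ennreal_divide_times emeasure_eq_measure)
    ultimately show ?thesis
      using \<open>0 \<le> K\<close> by (simp add: eq emeasure_eq_measure ennreal_mult A_def[symmetric])
  qed
qed

lemma (in prob_space) expectation_excess_le:
  assumes V[measurable]: "V \<in> borel_measurable M" and "0 \<le> K"
    and cond: "\<P>(x in M. V x > w) > 0 \<Longrightarrow> cond_exp_excess M V \<theta> w \<le> ennreal K"
  shows "integrable M (\<lambda>x. max 0 ((V x - w) * exp (\<theta> * (V x - w))))"
    and "expectation (\<lambda>x. max 0 ((V x - w) * exp (\<theta> * (V x - w)))) \<le> K * \<P>(x in M. V x > w)"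
proof -
  let ?f = "\<lambda>x. (V x - w) * exp (\<theta> * (V x - w))"
  have trunc: "ennreal (max 0 z) = ennreal z" for z
    by (auto simp: max_def ennreal_neg)
  have le: "(\<integral>\<^sup>+x. ennreal (max 0 (?f x)) \<partial>M) \<le> ennreal (K * \<P>(x in M. V x > w))"
    using excess_le_of_cond_exp_excess_le[OF assms] by (simp add: trunc)
  show int: "integrable M (\<lambda>x. max 0 (?f x))"
    using le by (intro integrableI_nonneg) (auto simp del: trunc intro: le_less_trans)
  have "ennreal (expectation (\<lambda>x. max 0 (?f x))) \<le> ennreal (K * \<P>(x in M. V x > w))"
    using le by (subst nn_integral_eq_integral[OF int, symmetric]) auto
  then show "expectation (\<lambda>x. max 0 (?f x)) \<le> K * \<P>(x in M. V x > w)"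
    using \<open>0 \<le> K\<close> by (subst (asm) ennreal_le_iff) auto
qed

lemma (in prob_space) integrable_tilted:
  fixes V :: "'a \<Rightarrow> real" and \<theta> :: real
  assumes V[measurable]: "V \<in> borel_measurable M" and \<theta>: "0 < \<theta>"
    and pos_part: "integrable M (\<lambda>x. max 0 (V x * exp (\<theta> * V x)))"
  shows "integrable M (\<lambda>x. V x * exp (\<theta> * V x))"
proof (rule Bochner_Integration.integrable_bound)
  show "integrable M (\<lambda>x. max 0 (V x * exp (\<theta> * V x)) + 1 / \<theta>)"
    using pos_part by auto
  show "AE x in M. norm (V x * exp (\<theta> * V x)) \<le> norm (max 0 (V x * exp (\<theta> * V x)) + 1 / \<theta>)"
  proof (intro AE_I2)
    fix x
    \<comment> \<open>\<open>- y * exp y \<le> 1\<close> bounds the negative part.\<close>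
    have "- (\<theta> * V x) \<le> exp (- (\<theta> * V x))"
      using exp_ge_add_one_self[of "- (\<theta> * V x)"] by linarith
    then have "- (\<theta> * V x) * exp (\<theta> * V x) \<le> exp (- (\<theta> * V x)) * exp (\<theta> * V x)"
      by (intro mult_right_mono) auto
    also have "\<dots> = 1"
      using exp_minus_inverse[of "\<theta> * V x"] by (simp only: mult.commute)
    finally have "- (V x * exp (\<theta> * V x)) \<le> 1 / \<theta>"
      using \<theta> by (simp add: field_simps)
    moreover have "0 < 1 / \<theta>"
      using \<theta> by simp
    ultimately show "norm (V x * exp (\<theta> * V x)) \<le> norm (max 0 (V x * exp (\<theta> * V x)) + 1 / \<theta>)"
      unfolding real_norm_def by linarith
  qed
qed auto

text \<open>The drift inequality before taking expectations, in terms of the displacements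
  \<open>x = U - u\<close> and \<open>y = V - v\<close>. The step survives when \<open>x \<le> 0\<close> and \<open>y \<le> a\<close>. If it is lost
  with \<open>x > 0\<close> and \<open>y \<le> a\<close>, the term \<open>exp (\<theta>1 * x) \<ge> 1\<close> pays for this.
  If it is lost with \<open>y > a\<close>, then \<open>c0\<close> is large enough to pay, except that the polynomial may
  have become negative; the last summand of the bound accounts for this and has nonnegative
  expectation when \<open>K\<close> bounds the conditional excess of \<open>V\<close>. For a surviving step the minimum
  of the two coordinates costs at most \<open>exp (\<theta>1 * y) \<le> exp ((\<theta>1 - \<theta>2) * a) * exp (\<theta>2 * y)\<close>.\<close>

lemma drift_lower_bound:
  fixes x y a K c0 c1 \<theta>1 \<theta>2 :: real
  assumes \<theta>: "0 < \<theta>2" "\<theta>2 \<le> \<theta>1" and "0 \<le> K" "0 \<le> c1"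
    and c0: "exp (- \<theta>2 * a) + c1 * (\<bar>a\<bar> + K) \<le> c0"
  shows "1 - exp (\<theta>1 * x) - (exp ((\<theta>1 - \<theta>2) * a) + c0 - c1 * y) * exp (\<theta>2 * y)
      + c1 * exp (\<theta>2 * a) * (K * of_bool (a < y) - max 0 ((y - a) * exp (\<theta>2 * (y - a))))
    \<le> (if x \<le> 0 \<and> y \<le> a
        then 1 - exp (\<theta>1 * max x y) - (c0 - c1 * y) * exp (\<theta>2 * y) else 0)"
proof (cases "y \<le> a")
  case True
  have no_excess: "max 0 ((y - a) * exp (\<theta>2 * (y - a))) = 0"
    using True by (simp add: mult_nonpos_nonneg)
  have "exp (\<theta>1 * y) = exp ((\<theta>1 - \<theta>2) * y) * exp (\<theta>2 * y)"
    by (simp add: algebra_simps flip: exp_add)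
  also have "\<dots> \<le> exp ((\<theta>1 - \<theta>2) * a) * exp (\<theta>2 * y)"
    using True \<theta> by (intro mult_right_mono) (auto intro: mult_left_mono)
  finally have y: "exp (\<theta>1 * y) \<le> exp ((\<theta>1 - \<theta>2) * a) * exp (\<theta>2 * y)" .
  have max: "exp (\<theta>1 * max x y) \<le> exp (\<theta>1 * x) + exp (\<theta>1 * y)"
    by (auto simp: max_def)
  have "c1 * y \<le> c1 * \<bar>a\<bar>"
    using True \<open>0 \<le> c1\<close> by (intro mult_left_mono) auto
  moreover have "0 \<le> c1 * K"
    using assms by simp
  ultimately have "0 \<le> c0 - c1 * y"
    using c0 exp_gt_zero[of "- \<theta>2 * a"] unfolding distrib_left by linarith
  then have poly: "0 \<le> (c0 - c1 * y) * exp (\<theta>2 * y)"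
    by simp
  have x: "1 \<le> exp (\<theta>1 * x)" if "0 < x"
    using that \<theta> by simp
  have "0 \<le> exp ((\<theta>1 - \<theta>2) * a) * exp (\<theta>2 * y)"
    by simp
  then obtain G where G: "exp ((\<theta>1 - \<theta>2) * a) * exp (\<theta>2 * y) = G" "0 \<le> G"
    by blast
  note bounds = G(2) y[unfolded G(1)] max poly
  have expand: "(exp ((\<theta>1 - \<theta>2) * a) + c0 - c1 * y) * exp (\<theta>2 * y)
      = G + (c0 - c1 * y) * exp (\<theta>2 * y)"
    unfolding G(1)[symmetric] by algebra
  have inside: "of_bool (a < y) = (0::real)"
    using True by simp
  show ?thesis
    unfolding expand no_excess inside using bounds x True
    by (cases "x \<le> 0") (auto simp del: one_le_exp_iff)
next
  case False
  define z where "z = y - a"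
  have z: "0 < z" and y_eq: "y = z + a" using False by (auto simp: z_def)
  have split: "exp (\<theta>2 * y) = exp (\<theta>2 * z) * exp (\<theta>2 * a)"
    by (simp add: y_eq algebra_simps flip: exp_add)
  have "1 \<le> exp (\<theta>2 * z)" using z \<theta> by simp
  have "exp (- \<theta>2 * a) + c1 * K - c1 * z \<le> c0 - c1 * y"
  proof -
    have "c1 * a \<le> c1 * \<bar>a\<bar>"
      using \<open>0 \<le> c1\<close> by (intro mult_left_mono) auto
    then show ?thesis
      using c0 by (simp add: y_eq algebra_simps)
  qed
  then have "(exp (- \<theta>2 * a) + c1 * K - c1 * z) * exp (\<theta>2 * y) \<le> (c0 - c1 * y) * exp (\<theta>2 * y)"
    by (intro mult_right_mono) auto
  moreover have "(exp (- \<theta>2 * a) + c1 * K - c1 * z) * exp (\<theta>2 * y)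
      = exp (\<theta>2 * z) + c1 * exp (\<theta>2 * a) * (K * exp (\<theta>2 * z) - z * exp (\<theta>2 * z))"
  proof -
    have "exp (- \<theta>2 * a) * exp (\<theta>2 * a) = 1"
      using exp_minus_inverse[of "\<theta>2 * a"] by (simp add: mult.commute)
    then show ?thesis
      unfolding split by algebra
  qed
  moreover have "c1 * exp (\<theta>2 * a) * (K * exp (\<theta>2 * z) - z * exp (\<theta>2 * z))
      \<ge> c1 * exp (\<theta>2 * a) * (K - z * exp (\<theta>2 * z))"
    using assms \<open>1 \<le> exp (\<theta>2 * z)\<close> mult_left_mono[of 1 "exp (\<theta>2 * z)" K]
    by (intro mult_left_mono) auto
  moreover have "0 \<le> exp (\<theta>1 * x)" "0 \<le> exp ((\<theta>1 - \<theta>2) * a) * exp (\<theta>2 * y)"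
    by auto
  moreover have "(exp ((\<theta>1 - \<theta>2) * a) + c0 - c1 * y) * exp (\<theta>2 * y)
      = exp ((\<theta>1 - \<theta>2) * a) * exp (\<theta>2 * y) + (c0 - c1 * y) * exp (\<theta>2 * y)"
    by algebra
  ultimately have "1 - exp (\<theta>1 * x) - (exp ((\<theta>1 - \<theta>2) * a) + c0 - c1 * y) * exp (\<theta>2 * y)
      + c1 * exp (\<theta>2 * a) * (K - z * exp (\<theta>2 * z)) \<le> 0"
    using \<open>1 \<le> exp (\<theta>2 * z)\<close> by linarith
  moreover have excess: "max 0 ((y - a) * exp (\<theta>2 * (y - a))) = z * exp (\<theta>2 * z)"
    unfolding z_def[symmetric] using z by simp
  moreover have outside: "of_bool (a < y) = (1::real)"
    using False by simp
  ultimately show ?thesis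
    unfolding excess outside using False by simp
qed

text \<open>Taking expectations in the bound above. The contribution of \<open>V\<close> amounts to the hypothesis
  \<open>balance\<close>, in which \<open>m\<close> and \<open>\<beta>\<close> are the exponential moment of \<open>V\<close> at \<open>\<theta>2\<close> and its slope.
  The restriction \<open>- a \<le> v\<close> places the level \<open>v + a\<close>, beyond which the step leaves the domain,
  in the range where the conditional excess is controlled.\<close>

lemma (in prob_space) drift_inequality:
  fixes U V :: "'a \<Rightarrow> real" and a K c0 c1 \<theta>1 \<theta>2 :: real
  defines "m \<equiv> expectation (\<lambda>x. exp (\<theta>2 * V x))"
    and "\<beta> \<equiv> expectation (\<lambda>x. V x * exp (\<theta>2 * V x))"
  assumes [measurable]: "U \<in> borel_measurable M" "V \<in> borel_measurable M"
    and \<theta>: "0 < \<theta>2" "\<theta>2 \<le> \<theta>1" and "0 \<le> K" "0 \<le> c1"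
    and c0: "exp (- \<theta>2 * a) + c1 * (\<bar>a\<bar> + K) \<le> c0"
    and intU: "integrable M (\<lambda>x. exp (\<theta>1 * U x))" and U_le: "expectation (\<lambda>x. exp (\<theta>1 * U x)) \<le> 1"
    and intV: "integrable M (\<lambda>x. exp (\<theta>2 * V x))" "integrable M (\<lambda>x. V x * exp (\<theta>2 * V x))"
    and excess: "\<And>w. 0 \<le> w \<Longrightarrow> \<P>(x in M. V x > w) > 0 \<Longrightarrow> cond_exp_excess M V \<theta>2 w \<le> ennreal K"
    and "- a \<le> v"
    and balance: "(exp ((\<theta>1 - \<theta>2) * a) + c0 + c1 * v) * m - c1 * \<beta> \<le> c0 + c1 * v"
  shows "1 - exp (- \<theta>1 * u) - (c0 + c1 * v) * exp (- \<theta>2 * v)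
    \<le> expectation (\<lambda>x. if U x \<le> u \<and> V x \<le> v + a
        then 1 - exp (\<theta>1 * max (U x - u) (V x - v))
          - (c0 + c1 * (v - V x)) * exp (\<theta>2 * (V x - v)) else 0)"
    (is "_ \<le> expectation ?g")
proof -
  let ?C = "exp ((\<theta>1 - \<theta>2) * a)"
  let ?E = "\<lambda>x. max 0 ((V x - (v + a)) * exp (\<theta>2 * (V x - (v + a))))"
  let ?T = "\<lambda>x. of_bool (v + a < V x) :: real"
  let ?p = "\<lambda>x. (?C + c0 + c1 * v) * (exp (- \<theta>2 * v) * exp (\<theta>2 * V x))
    - c1 * (exp (- \<theta>2 * v) * (V x * exp (\<theta>2 * V x)))"
  let ?h = "\<lambda>x. 1 - exp (- \<theta>1 * u) * exp (\<theta>1 * U x) - ?p x + c1 * exp (\<theta>2 * a) * (K * ?T x - ?E x)"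
  have shiftU: "exp (\<theta>1 * (U x - u)) = exp (- \<theta>1 * u) * exp (\<theta>1 * U x)" for x
    by (simp add: algebra_simps flip: exp_add)
  have shiftV: "exp (\<theta>2 * (V x - v)) = exp (- \<theta>2 * v) * exp (\<theta>2 * V x)" for x
    by (simp add: algebra_simps flip: exp_add)
  have g_ge: "?h x \<le> ?g x" for x
    using drift_lower_bound[OF \<theta> \<open>0 \<le> K\<close> \<open>0 \<le> c1\<close> c0, of "U x - u" "V x - v"]
    unfolding shiftU shiftV by (auto simp: algebra_simps)
  have w: "0 \<le> v + a" using \<open>- a \<le> v\<close> by simp
  note E = expectation_excess_le[OF assms(4) \<open>0 \<le> K\<close> excess[OF w]]
  have intT: "integrable M ?T"
    by (intro integrable_const_bound[of _ 1]) auto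
  have exp_T: "expectation ?T = \<P>(x in M. v + a < V x)"
  proof -
    have "expectation ?T = expectation (indicator {x \<in> space M. v + a < V x})"
      by (intro Bochner_Integration.integral_cong) (auto simp: indicator_def)
    then show ?thesis by simp
  qed
  have int_p: "integrable M ?p" and exp_p: "expectation ?p
      = exp (- \<theta>2 * v) * ((?C + c0 + c1 * v) * m - c1 * \<beta>)"
    using intV by (auto simp: m_def \<beta>_def right_diff_distrib)
  have int_g: "integrable M ?g"
  proof (rule Bochner_Integration.integrable_bound)
    let ?q = "\<lambda>x. (c0 + c1 * v) * (exp (- \<theta>2 * v) * exp (\<theta>2 * V x))
      - c1 * (exp (- \<theta>2 * v) * (V x * exp (\<theta>2 * V x)))"
    show "integrable M (\<lambda>x. 1 + exp (\<theta>1 * \<bar>a\<bar>) + \<bar>?q x\<bar>)"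
      using intV by auto
    have q: "(c0 + c1 * (v - V x)) * exp (\<theta>2 * (V x - v)) = ?q x" for x
      unfolding shiftV by (simp add: algebra_simps)
    have "\<theta>1 * max (U x - u) (V x - v) \<le> \<theta>1 * \<bar>a\<bar>" if "U x \<le> u" "V x \<le> v + a" for x
      using that \<theta> by (intro mult_left_mono) auto
    then have "\<bar>?g x\<bar> \<le> \<bar>1 + exp (\<theta>1 * \<bar>a\<bar>) + \<bar>?q x\<bar>\<bar>" for x
      unfolding q by (smt (verit) exp_gt_zero exp_le_cancel_iff)
    then show "AE x in M. norm (?g x) \<le> norm (1 + exp (\<theta>1 * \<bar>a\<bar>) + \<bar>?q x\<bar>)"
      by simp
  qed auto
  have "1 - exp (- \<theta>1 * u) - exp (- \<theta>2 * v) * (c0 + c1 * v)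
    \<le> 1 - exp (- \<theta>1 * u) * expectation (\<lambda>x. exp (\<theta>1 * U x)) - expectation ?p
      + c1 * exp (\<theta>2 * a) * (K * \<P>(x in M. v + a < V x) - expectation ?E)"
  proof -
    have "exp (- \<theta>1 * u) * expectation (\<lambda>x. exp (\<theta>1 * U x)) \<le> exp (- \<theta>1 * u) * 1"
      using U_le by (intro mult_left_mono) auto
    moreover have "expectation ?p \<le> exp (- \<theta>2 * v) * (c0 + c1 * v)"
      unfolding exp_p using balance by (intro mult_left_mono) auto
    moreover have "0 \<le> c1 * exp (\<theta>2 * a) * (K * \<P>(x in M. v + a < V x) - expectation ?E)"
      using E(2) \<open>0 \<le> c1\<close> by simp
    ultimately show ?thesis by linarith
  qed
  also have "\<dots> = expectation ?h"
    using intU int_p intT E(1)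
    by (simp add: exp_T prob_space del: of_bool_eq_iff)
  also have "\<dots> \<le> expectation ?g"
    using intU int_p intT E(1) int_g g_ge
    by (intro integral_mono) auto
  finally show ?thesis
    by (simp add: mult.commute)
qed

text \<open>If \<open>m < 1\<close>, the polynomial can be a constant: its own contraction absorbs the cost \<open>C\<close>.
  If \<open>m = 1\<close>, constants are preserved exactly and only a linear term produces a gain, at the
  rate \<open>\<beta> > 0\<close>. This is why the degree depends on whether \<open>m = 1\<close>.\<close>

lemma ex_balanced_coefficients:
  fixes m \<beta> C q \<kappa> :: real
  assumes "m \<le> 1" "m = 1 \<Longrightarrow> 0 < \<beta>" "0 < C" "0 < q" "0 \<le> \<kappa>"
  shows "\<exists>c0 c1. 0 < c0 \<and> (if m = 1 then 0 < c1 else c1 = 0) \<and> q + c1 * \<kappa> \<le> c0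
    \<and> (\<forall>v. (C + c0 + c1 * v) * m - c1 * \<beta> \<le> c0 + c1 * v)"
proof (cases "m = 1")
  case True
  with assms have "0 < \<beta>" by simp
  with True assms show ?thesis
    by (intro exI[of _ "q + C / \<beta> * \<kappa>"] exI[of _ "C / \<beta>"]) (auto intro!: add_pos_nonneg)
next
  case False
  with assms have m: "0 < 1 - m" by simp
  define c where "c = max q (C * m / (1 - m))"
  have "C * m / (1 - m) \<le> c" by (simp add: c_def)
  then have "C * m \<le> c * (1 - m)"
    using m by (simp add: pos_divide_le_eq)
  then have "(C + c) * m \<le> c" by (simp add: algebra_simps)
  then show ?thesis
    using False assms by (intro exI[of _ c] exI[of _ 0]) (auto simp: c_def)
qed

section \<open>Properties of the test function\<close>

lemma polynomial2_of_degree_affine: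
  assumes "if d = 1 then c1 \<noteq> 0 else d = 0 \<and> c1 = 0 \<and> c0 \<noteq> 0"
  shows "polynomial2_of_degree d (\<lambda>u v. c0 + c1 * v)"
  unfolding polynomial2_of_degree_def
  using assms
  by (intro exI[of _ "\<lambda>i j. if i = 0 then (if j = 0 then c0 else c1) else 0"] conjI allI exI[of _ 0])
     (auto split: if_splits)

lemma gamma_off_le_one:
  assumes "\<And>u v. (u, v) \<in> D_set a \<Longrightarrow> 0 \<le> P2 u v"
  shows "gamma_off a \<theta>1 \<theta>2 1 P2 p \<le> 1"
proof (cases p)
  case (Pair u v)
  have "0 \<le> P2 (real_of_ereal u) (real_of_ereal v) * exp (- \<theta>2 * real_of_ereal v)"
    if "(real_of_ereal u, real_of_ereal v) \<in> D_set a"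
    using assms[OF that] by simp
  moreover have "0 \<le> 1 * exp (- \<theta>1 * real_of_ereal u)"
    by simp
  ultimately show ?thesis
    unfolding Pair gamma_off_def prod.case by (smt (verit))
qed

text \<open>The value one is approached along the diagonal, which runs inside the domain.\<close>

lemma gamma_limsup_eq_one:
  assumes nonneg: "\<And>u v. (u, v) \<in> D_set a \<Longrightarrow> 0 \<le> c0 + c1 * v" and \<theta>: "0 < \<theta>1" "0 < \<theta>2"
  shows "gamma_limsup a \<theta>1 \<theta>2 1 (\<lambda>u v. c0 + c1 * v) = 1"
proof (rule antisym)
  let ?\<gamma> = "gamma_off a \<theta>1 \<theta>2 1 (\<lambda>u v. c0 + c1 * v)"
  show "gamma_limsup a \<theta>1 \<theta>2 1 (\<lambda>u v. c0 + c1 * v) \<le> 1"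
    unfolding gamma_limsup_def
    using gamma_off_le_one[of a "\<lambda>u v. c0 + c1 * v"] nonneg by (intro Limsup_bounded) auto
  let ?d = "\<lambda>n :: nat. (ereal (real n), ereal (real n))"
  have diag: "filterlim ?d (at (\<infinity>, \<infinity>)) sequentially"
    unfolding filterlim_at
    by (auto intro!: tendsto_Pair simp: tendsto_PInfty_eq_at_top filterlim_real_sequentially)
  have "(\<lambda>n. 1 - 1 * exp (- \<theta>1 * real n) - (c0 + c1 * real n) * exp (- \<theta>2 * real n))
      \<longlonglongrightarrow> 1 - 0 - 0"
  proof (intro tendsto_diff tendsto_const)
    show "(\<lambda>n. 1 * exp (- \<theta>1 * real n)) \<longlonglongrightarrow> 0"
      using \<theta> by real_asymp
    show "(\<lambda>n. (c0 + c1 * real n) * exp (- \<theta>2 * real n)) \<longlonglongrightarrow> 0"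
      using \<theta> by real_asymp
  qed
  moreover have "\<forall>\<^sub>F n in sequentially.
      ?\<gamma> (?d n) = 1 - 1 * exp (- \<theta>1 * real n) - (c0 + c1 * real n) * exp (- \<theta>2 * real n)"
    using eventually_ge_at_top[of "nat \<lceil>\<bar>a\<bar>\<rceil>"]
    by eventually_elim (auto simp: gamma_off_def D_set_def)
  ultimately have "(\<lambda>n. ?\<gamma> (?d n)) \<longlonglongrightarrow> 1"
    by (simp add: tendsto_cong)
  then have "(\<lambda>n. ereal (?\<gamma> (?d n))) \<longlonglongrightarrow> 1"
    by (simp add: one_ereal_def)
  then have "1 = Limsup sequentially (\<lambda>n. ereal (?\<gamma> (?d n)))"
    by (simp add: lim_imp_Limsup)
  also have "\<dots> \<le> Limsup (filtermap ?d sequentially) (\<lambda>p. ereal (?\<gamma> p))"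
    by (rule Limsup_filtermap_ge)
  also have "\<dots> \<le> gamma_limsup a \<theta>1 \<theta>2 1 (\<lambda>u v. c0 + c1 * v)"
    unfolding gamma_limsup_def using diag
    by (auto intro!: INF_superset_mono simp: Limsup_def filterlim_def le_filter_def)
  finally show "1 \<le> gamma_limsup a \<theta>1 \<theta>2 1 (\<lambda>u v. c0 + c1 * v)" .
qed

text \<open>For \<open>U \<le> u\<close> the only way out of the domain is \<open>V > v + a\<close>: as long as \<open>v - V \<ge> - a\<close>, the
  minimum of \<open>u - U \<ge> 0\<close> and \<open>v - V\<close> automatically satisfies both constraints on the first
  coordinate.\<close>

lemma gamma_fun_step:
  fixes u v :: real and U V :: "'a \<Rightarrow> real"
  shows "indicator {x. ereal (U x) \<le> ereal u} x *
      gamma_fun a \<theta>1 \<theta>2 P1 P2 (min (ereal u - ereal (U x)) (ereal v - ereal (V x)), ereal v - ereal (V x))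
    = (if U x \<le> u \<and> V x \<le> v + a
       then 1 - P1 * exp (\<theta>1 * max (U x - u) (V x - v))
         - P2 (min (u - U x) (v - V x)) (v - V x) * exp (\<theta>2 * (V x - v)) else 0)"
proof -
  define s where "s = min (u - U x) (v - V x)"
  have steps: "min (ereal u - ereal (U x)) (ereal v - ereal (V x)) = ereal s"
      "ereal v - ereal (V x) = ereal (v - V x)"
    by (simp_all add: s_def)
  have min: "- min (u - U x) (v - V x) = max (U x - u) (V x - v)"
    by auto
  have "- \<theta>1 * min (u - U x) (v - V x) = \<theta>1 * max (U x - u) (V x - v)"
    unfolding min[symmetric] by simp
  moreover have "- \<theta>2 * (v - V x) = \<theta>2 * (V x - v)"
    by (simp add: algebra_simps)
  moreover have "(min (u - U x) (v - V x), v - V x) \<in> D_set a \<longleftrightarrow> V x \<le> v + a" if "U x \<le> u"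
    using that by (auto simp: D_set_def)
  ultimately show ?thesis
    unfolding s_def[symmetric] steps(1) unfolding steps(2)
    by (auto simp: gamma_fun_def gamma_off_def indicator_def)
qed

lemma supp_pos_gamma_fun_cases:
  assumes "(u, v) \<in> supp_pos (gamma_fun a \<theta>1 \<theta>2 P1 P2)"
  obtains "u = \<infinity>" "v = \<infinity>" | u' v' where "u = ereal u'" "v = ereal v'" "(u', v') \<in> D_set a"
  using assms
  by (cases u; cases v) (auto simp: supp_pos_def gamma_fun_def gamma_off_def split: if_splits)

section \<open>Existence of the test function\<close>

theorem theorem3:
  fixes M :: "'a measure" and U V :: "'a \<Rightarrow> real" and a K :: real
  assumes "prob_space M"
    and "U \<in> borel_measurable M" and "V \<in> borel_measurable M"
    and "\<P>(x in M. U x > 0) > 0" and "\<P>(x in M. V x > 0) > 0"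
    and "ext_expectation M U < 0" and "ext_expectation M V < 0"
    and "\<exists>\<theta>>0. mgf M U \<theta> < \<infinity> \<and> mgf M V \<theta> < \<infinity>"
    and "\<forall>v\<ge>0. \<P>(x in M. V x > v) > 0 \<longrightarrow>
           cond_exp_excess M V (theta2 M U V) v \<le> ennreal K"
  shows "\<exists>(P1 :: real) (P2 :: real \<Rightarrow> real \<Rightarrow> real).
    P1 \<ge> 0 \<and>
    polynomial2_of_degree (I_ind M V (theta2 M U V)) P2 \<and>
    (\<forall>(u, v) \<in> D_set a. P2 u v \<ge> 0) \<and>
    bdd_above (gamma_fun a (theta1 M U) (theta2 M U V) P1 P2 ` (- {(\<infinity>, \<infinity>)})) \<and>
    gamma_limsup a (theta1 M U) (theta2 M U V) P1 P2 = 1 \<and>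
    (\<forall>(u, v) \<in> supp_pos (gamma_fun a (theta1 M U) (theta2 M U V) P1 P2).
       (\<integral>x. indicator {x. ereal (U x) \<le> u} x *
            gamma_fun a (theta1 M U) (theta2 M U V) P1 P2
              (min (u - ereal (U x)) (v - ereal (V x)), v - ereal (V x)) \<partial>M)
         \<ge> gamma_fun a (theta1 M U) (theta2 M U V) P1 P2 (u, v))"
proof -
  interpret prob_space M by fact
  have [measurable]: "U \<in> borel_measurable M" "V \<in> borel_measurable M" by fact+
  define \<theta>1 \<theta>2 where "\<theta>1 = theta1 M U" and "\<theta>2 = theta2 M U V"
  define K' where "K' = max 0 K"
  have K': "0 \<le> K'" "ennreal K' = ennreal K"
    by (auto simp: K'_def max_def ennreal_neg)
  \<comment> \<open>The suprema are finite and positive, and the exponential moments at them are at most one.\<close>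
  let ?S1 = "{r. 0 < r \<and> mgf M U r \<le> 1}"
  let ?S2 = "{r. 0 < r \<and> max (mgf M V r) (mgf M U r) \<le> 1}"
  obtain \<theta> where "0 < \<theta>" "mgf M U \<theta> < \<infinity>" "mgf M V \<theta> < \<infinity>"
    using assms(8) by blast
  then obtain sU sV where s: "0 < sU" "mgf M U sU \<le> 1" "0 < sV" "mgf M V sV \<le> 1"
    using ex_mgf_le_one_if_negative_drift[of U \<theta>] ex_mgf_le_one_if_negative_drift[of V \<theta>] assms
    by blast
  have sub: "?S2 \<subseteq> ?S1" by auto
  have S2: "min sU sV \<in> ?S2"
    using s mgf_le_one_downward[of U "min sU sV" sU] mgf_le_one_downward[of V "min sU sV" sV]
    by auto
  have bdd1: "bdd_above ?S1"
    using assms by (intro bdd_above_mgf_le_one)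
  then have bdd2: "bdd_above ?S2"
    using sub by (rule bdd_above_mono)
  have "min sU sV \<le> \<theta>2"
    unfolding \<theta>2_def theta2_def using S2 bdd2 by (rule cSup_upper)
  then have \<theta>2_pos: "0 < \<theta>2" using s by auto
  have \<theta>2_le: "\<theta>2 \<le> \<theta>1"
    unfolding \<theta>1_def \<theta>2_def theta1_def theta2_def using S2 bdd1 sub by (intro cSup_subset_mono) auto
  have mgfU: "mgf M U \<theta>1 \<le> 1"
    unfolding \<theta>1_def theta1_def using S2 sub bdd1 by (intro mgf_Sup_le_one) auto
  have mgfV: "mgf M V \<theta>2 \<le> 1"
    unfolding \<theta>2_def theta2_def using S2 bdd2 by (intro mgf_Sup_le_one) auto
  have intU: "integrable M (\<lambda>x. exp (\<theta>1 * U x))"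
    using mgfU by (intro integrable_exp_if_mgf_finite) (auto intro: le_less_trans)
  have intV: "integrable M (\<lambda>x. exp (\<theta>2 * V x))"
    using mgfV by (intro integrable_exp_if_mgf_finite) (auto intro: le_less_trans)
  have excess: "cond_exp_excess M V \<theta>2 w \<le> ennreal K'" if "0 \<le> w" "\<P>(x in M. V x > w) > 0" for w
    using assms(9) that by (simp add: K' \<theta>2_def)
  have int_tilted: "integrable M (\<lambda>x. V x * exp (\<theta>2 * V x))"
    using expectation_excess_le(1)[of V K' 0 \<theta>2] excess[of 0] K' \<theta>2_pos
    by (intro integrable_tilted) auto
  \<comment> \<open>The position of \<open>m\<close> relative to one decides the degree and hence the choice of coefficients.\<close>
  define m \<beta> where "m = expectation (\<lambda>x. exp (\<theta>2 * V x))"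
    and "\<beta> = expectation (\<lambda>x. V x * exp (\<theta>2 * V x))"
  have mgf_m: "mgf M V \<theta>2 = ennreal m"
    unfolding m_def by (rule mgf_eq_integral[OF intV])
  have "m \<le> 1"
    using mgfV by (simp add: mgf_m)
  have degree: "I_ind M V \<theta>2 = (if m = 1 then 1 else 0)"
    by (simp add: I_ind_def mgf_m)
  have "0 < \<beta>" if "m = 1"
    unfolding \<beta>_def using that intV int_tilted \<theta>2_pos assms(5)
    by (intro expectation_tilted_pos) (auto simp: m_def)
  with \<open>m \<le> 1\<close> K' obtain c0 c1 where c: "0 < c0" "if m = 1 then 0 < c1 else c1 = 0"
    "exp (- \<theta>2 * a) + c1 * (\<bar>a\<bar> + K') \<le> c0"
    "\<And>v. (exp ((\<theta>1 - \<theta>2) * a) + c0 + c1 * v) * m - c1 * \<beta> \<le> c0 + c1 * v"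
    using ex_balanced_coefficients[of m \<beta> "exp ((\<theta>1 - \<theta>2) * a)" "exp (- \<theta>2 * a)" "\<bar>a\<bar> + K'"]
    by auto
  have c1: "0 \<le> c1" using c(2) by (auto split: if_splits)
  let ?P = "\<lambda>u v :: real. c0 + c1 * v"
  let ?\<gamma> = "gamma_fun a \<theta>1 \<theta>2 1 ?P"
  have nonneg: "0 \<le> c0 + c1 * v" if "(u, v) \<in> D_set a" for u v
  proof -
    have "c1 * (- \<bar>a\<bar>) \<le> c1 * v"
      using that c1 by (intro mult_left_mono) (auto simp: D_set_def)
    moreover have "0 \<le> c1 * K'" "0 < exp (- \<theta>2 * a)"
      using c1 K' by auto
    ultimately show ?thesis
      using c(3) unfolding distrib_left by linarith
  qed
  have limsup: "gamma_limsup a \<theta>1 \<theta>2 1 ?P = 1"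
    using nonneg \<theta>2_pos \<theta>2_le by (intro gamma_limsup_eq_one) auto
  have "bdd_above (?\<gamma> ` (- {(\<infinity>, \<infinity>)}))"
    using gamma_off_le_one[of a ?P \<theta>1 \<theta>2] nonneg
    by (intro bdd_aboveI2[of _ _ 1]) (simp add: gamma_fun_def)
  moreover have "?\<gamma> (u, v) \<le> (\<integral>x. indicator {x. ereal (U x) \<le> u} x *
      ?\<gamma> (min (u - ereal (U x)) (v - ereal (V x)), v - ereal (V x)) \<partial>M)"
    if "(u, v) \<in> supp_pos ?\<gamma>" for u v
    using that
  proof (cases rule: supp_pos_gamma_fun_cases)
    case 1
    then show ?thesis
      by (simp add: gamma_fun_def limsup prob_space)
  next
    case (2 u' v')
    have "?\<gamma> (u, v) = 1 - exp (- \<theta>1 * u') - (c0 + c1 * v') * exp (- \<theta>2 * v')"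
      using 2 by (simp add: gamma_fun_def gamma_off_def)
    also have "\<dots> \<le> expectation (\<lambda>x. if U x \<le> u' \<and> V x \<le> v' + a
        then 1 - exp (\<theta>1 * max (U x - u') (V x - v'))
          - (c0 + c1 * (v' - V x)) * exp (\<theta>2 * (V x - v')) else 0)"
    proof (rule drift_inequality[of U V \<theta>2 \<theta>1 K' c1 a c0])
      show "expectation (\<lambda>x. exp (\<theta>1 * U x)) \<le> 1"
        using mgfU by (simp add: mgf_eq_integral[OF intU])
      show "- a \<le> v'"
        using 2 by (simp add: D_set_def)
    qed (use \<theta>2_pos \<theta>2_le K' c1 c intU intV int_tilted excess in \<open>auto simp: m_def \<beta>_def\<close>)
    also have "\<dots> = (\<integral>x. indicator {x. ereal (U x) \<le> u} x *
      ?\<gamma> (min (u - ereal (U x)) (v - ereal (V x)), v - ereal (V x)) \<partial>M)"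
      unfolding 2 gamma_fun_step by (intro Bochner_Integration.integral_cong) auto
    finally show ?thesis .
  qed
  \<comment> \<open>The leading coefficient is \<open>c0\<close> if \<open>m < 1\<close> and \<open>c1\<close> if \<open>m = 1\<close>; both are nonzero then.\<close>
  moreover have "polynomial2_of_degree (I_ind M V \<theta>2) ?P"
    unfolding degree using c(1,2) by (intro polynomial2_of_degree_affine) auto
  ultimately show ?thesis
    unfolding \<theta>1_def[symmetric] \<theta>2_def[symmetric] using nonneg limsup
    by (intro exI[of _ 1] exI[of _ ?P]) auto
qed

end
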